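(* Let $(X,f)$ be a dynamical system with $X$ a Hausdorff space. (a) If $X$ is perfect, then the conditions $\mathrm{TT}_{++}$, $\mathrm{TT}_+$, $\mathrm{TT}$ and $\mathrm{IN}$ are equivalent for $(X,f)$. (b) If $X$ is perfect, then the conditions $\mathrm{DO}_{++}$ and $\mathrm{DO}_+$ are equivalent for $(X,f)$. (c) If $X$ is second countable and non-meager, then $\mathrm{TT}_+$ implies $\mathrm{DO}_+$ for $(X,f)$.
   Context: A dynamical system $(X,f)$ is a continuous map $f\colon X\to X$ on a nonempty topological space $X$; $f^0=\mathrm{id}$, $f^{n+1}=f\circ f^n$. $\mathbb N$ is the set of nonnegative integers. For $A\subset X$, $k\in\mathbb Z$, $f^k(A)$ is the image of $A$ under $f^k$ if $k\ge 0$ and the preimage of $A$ under $f^{|k|}$ if $k<0$. A set is opene if it is open and nonempty. $A$ is $+$invariant if $f(A)\subset A$. For $x\in X$, $O(x)=\{f^k(x):k\in\mathbb N\}$ is the forward orbit and $\omega f(x)=\bigcap_{n\ge0}\overline{\{f^k(x):k\ge n\}}$ is the omega-limit set. For $A,B\subset X$: $N(A,B)=\{k\in\mathbb Z: A\cap f^{-k}(B)\ne\varnothing\}$ and $N_+(A,B)=N(A,B)\cap\mathbb N$. A Hausdorff space is perfect if it has no isolated points (points $x$ with $\{x\}$ open). $X$ is non-meager if it is not the union of a countable family of nowhere dense subsets; second countable means having a countable base. Conditions on $(X,f)$: $\mathrm{IN}$: $X$ is not the union of two proper closed $+$invariant subsets. $\mathrm{TT}$: for all opene $U,V\subset X$,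 $N(U,V)\neq\varnothing$. $\mathrm{TT}_+$: for all opene $U,V\subset X$, $N_+(U,V)\ne\varnothing$. $\mathrm{TT}_{++}$: for all opene $U,V\subset X$, $N_+(U,V)$ is infinite. $\mathrm{DO}_+$: there is $x\in X$ with $O(x)$ dense in $X$. $\mathrm{DO}_{++}$: there is $x\in X$ with $\omega f(x)=X$. *)

theory Defs
  imports "HOL-Analysis.Analysis"
begin

text \<open>
  Spaces are explicit topologies \<open>X :: 'a topology\<close> with carrier \<open>topspace X\<close>, and a map on the
  space is a function \<open>f :: 'a \<Rightarrow> 'a\<close>, whose values outside \<open>topspace X\<close> play no role.
\<close>

definition dynamical_system :: "'a topology \<Rightarrow> ('a \<Rightarrow> 'a) \<Rightarrow> bool" where
  "dynamical_system X f \<longleftrightarrow> topspace X \<noteq> {} \<and> continuous_map X X f"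

definition no_isolated_points :: "'a topology \<Rightarrow> bool" where
  "no_isolated_points X \<longleftrightarrow> (\<forall>x\<in>topspace X. \<not> openin X {x})"

definition nowhere_dense_in :: "'a topology \<Rightarrow> 'a set \<Rightarrow> bool" where
  "nowhere_dense_in X A \<longleftrightarrow> A \<subseteq> topspace X \<and> X interior_of (X closure_of A) = {}"

definition non_meager :: "'a topology \<Rightarrow> bool" where
  "non_meager X \<longleftrightarrow>
     \<not> (\<exists>\<A>. countable \<A> \<and> (\<forall>A\<in>\<A>. nowhere_dense_in X A) \<and> \<Union>\<A> = topspace X)"

definition opene_in :: "'a topology \<Rightarrow> 'a set \<Rightarrow> bool" where
  "opene_in X U \<longleftrightarrow> openin X U \<and> U \<noteq> {}"

definition dense_in :: "'a topology \<Rightarrow> 'a set \<Rightarrow> bool" where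
  "dense_in X A \<longleftrightarrow> X closure_of A = topspace X"

text \<open>The set \<open>f\<^sup>k(A)\<close> for an integer \<open>k\<close>: an image for \<open>k \<ge> 0\<close>, a preimage for \<open>k < 0\<close>.\<close>

definition iter_image :: "'a topology \<Rightarrow> ('a \<Rightarrow> 'a) \<Rightarrow> int \<Rightarrow> 'a set \<Rightarrow> 'a set" where
  "iter_image X f k A =
     (if k \<ge> 0 then (f ^^ nat k) ` A else {x \<in> topspace X. (f ^^ nat \<bar>k\<bar>) x \<in> A})"

definition hitting_times :: "'a topology \<Rightarrow> ('a \<Rightarrow> 'a) \<Rightarrow> 'a set \<Rightarrow> 'a set \<Rightarrow> int set" where
  "hitting_times X f A B = {k. A \<inter> iter_image X f (- k) B \<noteq> {}}"

text \<open>Here \<open>\<nat>\<close> is the set of nonnegative integers as a subset of type \<open>int\<close>.\<close>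

definition hitting_times_plus :: "'a topology \<Rightarrow> ('a \<Rightarrow> 'a) \<Rightarrow> 'a set \<Rightarrow> 'a set \<Rightarrow> int set" where
  "hitting_times_plus X f A B = hitting_times X f A B \<inter> \<nat>"

definition plus_invariant :: "('a \<Rightarrow> 'a) \<Rightarrow> 'a set \<Rightarrow> bool" where
  "plus_invariant f A \<longleftrightarrow> f ` A \<subseteq> A"

definition forward_orbit :: "('a \<Rightarrow> 'a) \<Rightarrow> 'a \<Rightarrow> 'a set" where
  "forward_orbit f x = {(f ^^ k) x | k. True}"

definition omega_limit :: "'a topology \<Rightarrow> ('a \<Rightarrow> 'a) \<Rightarrow> 'a \<Rightarrow> 'a set" where
  "omega_limit X f x = (\<Inter>n. X closure_of {(f ^^ k) x | k. k \<ge> n})"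

definition cond_IN :: "'a topology \<Rightarrow> ('a \<Rightarrow> 'a) \<Rightarrow> bool" where
  "cond_IN X f \<longleftrightarrow>
     \<not> (\<exists>A B. closedin X A \<and> closedin X B \<and> A \<noteq> topspace X \<and> B \<noteq> topspace X \<and>
            plus_invariant f A \<and> plus_invariant f B \<and> topspace X = A \<union> B)"

definition cond_TT :: "'a topology \<Rightarrow> ('a \<Rightarrow> 'a) \<Rightarrow> bool" where
  "cond_TT X f \<longleftrightarrow> (\<forall>U V. opene_in X U \<and> opene_in X V \<longrightarrow> hitting_times X f U V \<noteq> {})"

definition cond_TT_plus :: "'a topology \<Rightarrow> ('a \<Rightarrow> 'a) \<Rightarrow> bool" where
  "cond_TT_plus X f \<longleftrightarrow>
     (\<forall>U V. opene_in X U \<and> opene_in X V \<longrightarrow> hitting_times_plus X f U V \<noteq> {})"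

definition cond_TT_plus_plus :: "'a topology \<Rightarrow> ('a \<Rightarrow> 'a) \<Rightarrow> bool" where
  "cond_TT_plus_plus X f \<longleftrightarrow>
     (\<forall>U V. opene_in X U \<and> opene_in X V \<longrightarrow> infinite (hitting_times_plus X f U V))"

definition cond_DO_plus :: "'a topology \<Rightarrow> ('a \<Rightarrow> 'a) \<Rightarrow> bool" where
  "cond_DO_plus X f \<longleftrightarrow> (\<exists>x\<in>topspace X. dense_in X (forward_orbit f x))"

definition cond_DO_plus_plus :: "'a topology \<Rightarrow> ('a \<Rightarrow> 'a) \<Rightarrow> bool" where
  "cond_DO_plus_plus X f \<longleftrightarrow> (\<exists>x\<in>topspace X. omega_limit X f x = topspace X)"

end

theory Submission
  imports Defs
begin

text \<open>
  If \<open>U\<close> cannot be reached from \<open>x\<close>, then it cannot be reached from \<open>f x\<close>; so for open \<open>U\<close> the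
  points that never reach \<open>U\<close> form a closed \<open>+\<close>invariant set, and \<open>IN\<close> says that some point
  reaches both \<open>U\<close> and \<open>V\<close>, which is \<open>TT\<close>. In a perfect Hausdorff space an opene set contains two
  disjoint opene sets, so \<open>TT\<close> yields positive return times \<open>W \<rightarrow> W\<close>, and iterating on
  \<open>W \<inter> f\<^sup>-\<^sup>k(W)\<close> yields unboundedly many. If \<open>V\<close> reaches \<open>U\<close> at time \<open>n\<close>, a return of
  \<open>V \<inter> f\<^sup>-\<^sup>n(U)\<close> at a time \<open>m \<ge> n\<close> takes \<open>U\<close> to \<open>V\<close> in \<open>m - n\<close> steps, which gives \<open>TT\<^sub>+\<^sub>+\<close>.
  For (b), deleting finitely many points from a dense subset of a perfect Hausdorff space keeps it
  dense. Part (c) is the Baire category argument: under \<open>TT\<^sub>+\<close> the points that never reach a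
  given basic opene set form a nowhere dense set.
\<close>

section \<open>Hitting times as sets of natural numbers\<close>

definition hits :: "('a \<Rightarrow> 'a) \<Rightarrow> 'a set \<Rightarrow> 'a set \<Rightarrow> nat set" where
  "hits f U V = {n. \<exists>x\<in>U. (f ^^ n) x \<in> V}"

lemma mem_hits_iff: "n \<in> hits f U V \<longleftrightarrow> (\<exists>x\<in>U. (f ^^ n) x \<in> V)"
  by (simp add: hits_def)

lemma int_mem_hitting_times_iff:
  assumes "U \<subseteq> topspace X"
  shows "int n \<in> hitting_times X f U V \<longleftrightarrow> n \<in> hits f U V"
  \<comment> \<open>At \<open>n = 0\<close> the set \<open>iter_image X f (- int n) V\<close> is an
    image; for larger \<open>n\<close> it is a preimage, cut down to
    \<open>topspace X\<close>.\<close>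
  using assms by (cases "n = 0") (auto simp: hitting_times_def iter_image_def hits_def)

text \<open>A negative time turns the preimage of \<open>V\<close> into a forward image, which swaps
  the roles of \<open>U\<close> and \<open>V\<close>.\<close>

lemma minus_int_mem_hitting_times_iff:
  "- int n \<in> hitting_times X f U V \<longleftrightarrow> n \<in> hits f V U"
  by (auto simp: hitting_times_def iter_image_def hits_def)

lemma hitting_times_plus_eq:
  assumes "U \<subseteq> topspace X"
  shows "hitting_times_plus X f U V = int ` hits f U V"
  using int_mem_hitting_times_iff[OF assms]
  by (auto simp: hitting_times_plus_def elim!: Nats_cases)

lemma hitting_times_nonempty_iff:
  assumes "U \<subseteq> topspace X"
  shows "hitting_times X f U V \<noteq> {} \<longleftrightarrow> hits f U V \<noteq> {} \<or> hits f V U \<noteq> {}"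
proof
  assume "hitting_times X f U V \<noteq> {}"
  then obtain k where k: "k \<in> hitting_times X f U V" by blast
  show "hits f U V \<noteq> {} \<or> hits f V U \<noteq> {}"
  proof (cases k rule: int_cases2)
    case (nonneg n)
    with k int_mem_hitting_times_iff[OF assms] show ?thesis by blast
  next
    case (nonpos n)
    with k minus_int_mem_hitting_times_iff show ?thesis by blast
  qed
next
  assume "hits f U V \<noteq> {} \<or> hits f V U \<noteq> {}"
  then show "hitting_times X f U V \<noteq> {}"
    using int_mem_hitting_times_iff[OF assms] minus_int_mem_hitting_times_iff by blast
qed

lemma opene_in_subset_topspace: "opene_in X U \<Longrightarrow> U \<subseteq> topspace X"
  by (simp add: opene_in_def openin_subset)

lemma cond_TT_iff:
  "cond_TT X f \<longleftrightarrow>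
    (\<forall>U V. opene_in X U \<and> opene_in X V \<longrightarrow> hits f U V \<noteq> {} \<or> hits f V U \<noteq> {})"
  unfolding cond_TT_def using hitting_times_nonempty_iff opene_in_subset_topspace by metis

lemma cond_TT_plus_iff:
  "cond_TT_plus X f \<longleftrightarrow> (\<forall>U V. opene_in X U \<and> opene_in X V \<longrightarrow> hits f U V \<noteq> {})"
  unfolding cond_TT_plus_def using hitting_times_plus_eq opene_in_subset_topspace
  by (metis image_is_empty)

lemma cond_TT_plus_plus_iff:
  "cond_TT_plus_plus X f \<longleftrightarrow> (\<forall>U V. opene_in X U \<and> opene_in X V \<longrightarrow> infinite (hits f U V))"
  unfolding cond_TT_plus_plus_def using hitting_times_plus_eq opene_in_subset_topspace
  by (metis finite_image_iff inj_on_of_nat)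

section \<open>Iterates of a continuous map\<close>

lemma funpow_diff_apply:
  assumes "i \<le> j"
  shows "(f ^^ (j - i)) ((f ^^ i) x) = (f ^^ j) x"
  by (metis assms comp_apply funpow_add le_add_diff_inverse2)

lemma continuous_map_funpow:
  assumes "continuous_map X X f"
  shows "continuous_map X X (f ^^ n)"
proof (induction n)
  case 0
  show ?case by (simp add: id_def)
next
  case (Suc n)
  then show ?case using continuous_map_compose[OF Suc assms] by (simp add: o_def)
qed

lemma openin_funpow_preimage:
  assumes "continuous_map X X f" and "openin X U" and "openin X V"
  shows "openin X {x \<in> U. (f ^^ n) x \<in> V}"
proof -
  have "openin X (U \<inter> {x \<in> topspace X. (f ^^ n) x \<in> V})"
    using assms continuous_map_funpow[OF assms(1), of n]
    by (intro openin_Int) (auto simp: continuous_map_def)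
  moreover have "U \<inter> {x \<in> topspace X. (f ^^ n) x \<in> V} = {x \<in> U. (f ^^ n) x \<in> V}"
    using openin_subset[OF assms(2)] by auto
  ultimately show ?thesis by simp
qed

lemma opene_in_funpow_preimage:
  assumes "continuous_map X X f" and "opene_in X U" and "opene_in X V" and "n \<in> hits f U V"
  shows "opene_in X {x \<in> U. (f ^^ n) x \<in> V}"
  using assms openin_funpow_preimage by (fastforce simp: opene_in_def mem_hits_iff)

section \<open>Open sets in perfect spaces\<close>

lemma perfect_open_infinite:
  assumes "t1_space X" and "no_isolated_points X" and "opene_in X U"
  shows "infinite U"
proof
  assume fin: "finite U"
  from assms(3) obtain x where x: "x \<in> U" "openin X U" by (auto simp: opene_in_def)
  \<comment> \<open>Finite sets are closed in a T1 space, so removing \<open>U - {x}\<close> from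
    \<open>U\<close> would leave \<open>x\<close> isolated.\<close>
  have "closedin X (U - {x})"
    using assms(1) fin openin_subset[OF x(2)] by (auto simp: t1_space_closedin_finite)
  then have "openin X (U - (U - {x}))"
    using x(2) by (rule openin_diff[rotated])
  moreover have "U - (U - {x}) = {x}" using x by auto
  ultimately show False
    using assms(2) x openin_subset by (fastforce simp: no_isolated_points_def)
qed

text \<open>An infinite \<open>U\<close> has two distinct points; their separating neighbourhoods
  are cut down to \<open>U\<close>.\<close>

lemma perfect_open_disjoint_subsets:
  assumes "Hausdorff_space X" and "no_isolated_points X" and "opene_in X U"
  obtains V W where "opene_in X V" "opene_in X W" "V \<subseteq> U" "W \<subseteq> U" "disjnt V W"
proof -
  have U: "openin X U" and inf: "infinite U"
    using assms perfect_open_infinite Hausdorff_imp_t1_space by (auto simp: opene_in_def)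
  then obtain x y where xy: "x \<in> U" "y \<in> U" "x \<noteq> y"
    by (metis finite.emptyI finite.insertI finite_subset insertI1 subsetI)
  then obtain P Q where PQ: "openin X P" "openin X Q" "x \<in> P" "y \<in> Q" "disjnt P Q"
    using assms(1) openin_subset[OF U] unfolding Hausdorff_space_def by (metis subsetD)
  show thesis
  proof (rule that[of "P \<inter> U" "Q \<inter> U"])
    show "opene_in X (P \<inter> U)" "opene_in X (Q \<inter> U)"
      using PQ U xy by (auto simp: opene_in_def)
  qed (use PQ in \<open>auto simp: disjnt_def\<close>)
qed

section \<open>Return times and \<open>TT\<^sub>+\<^sub>+\<close>\<close>

lemma cond_TT_imp_positive_return:
  assumes "Hausdorff_space X" and "no_isolated_points X" and "cond_TT X f" and "opene_in X W"
  shows "\<exists>n>0. n \<in> hits f W W"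
proof -
  obtain U V where UV: "opene_in X U" "opene_in X V" "U \<subseteq> W" "V \<subseteq> W" "disjnt U V"
    using perfect_open_disjoint_subsets[OF assms(1,2,4)] .
  then obtain n where "n \<in> hits f U V \<or> n \<in> hits f V U"
    using assms(3) unfolding cond_TT_iff by blast
  \<comment> \<open>Disjointness of \<open>U\<close> and \<open>V\<close> excludes time 0, at which
    \<open>W\<close> always meets itself.\<close>
  with UV have "n \<in> hits f W W" "n \<noteq> 0"
    by (auto simp: mem_hits_iff disjnt_iff intro: gr0I)
  then show ?thesis by auto
qed

lemma cond_TT_imp_large_return:
  assumes "continuous_map X X f" and "Hausdorff_space X" and "no_isolated_points X"
    and "cond_TT X f" and "opene_in X W"
  shows "\<exists>n\<ge>N. n \<in> hits f W W"
proof (induction N)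
  case 0
  show ?case using cond_TT_imp_positive_return[OF assms(2-5)] by blast
next
  case (Suc N)
  then obtain n where n: "n \<ge> N" "n \<in> hits f W W" by blast
  define W' where "W' = {x \<in> W. (f ^^ n) x \<in> W}"
  have "opene_in X W'"
    unfolding W'_def using assms n by (intro opene_in_funpow_preimage) auto
  then obtain j where j: "j > 0" "j \<in> hits f W' W'"
    using cond_TT_imp_positive_return[OF assms(2-4)] by blast
  \<comment> \<open>Since \<open>(f ^^ j) x\<close> is again in \<open>W'\<close>, it is back in
    \<open>W\<close> after \<open>n\<close> further steps.\<close>
  then obtain x where "x \<in> W" "(f ^^ n) ((f ^^ j) x) \<in> W"
    by (auto simp: mem_hits_iff W'_def)
  then have "n + j \<in> hits f W W" by (auto simp: mem_hits_iff funpow_add)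
  with n(1) j(1) show ?case by (intro exI[of _ "n + j"]) auto
qed

lemma cond_TT_imp_TT_plus_plus:
  assumes "continuous_map X X f" and "Hausdorff_space X" and "no_isolated_points X"
    and "cond_TT X f"
  shows "cond_TT_plus_plus X f"
  unfolding cond_TT_plus_plus_iff
proof (intro allI impI)
  fix U V assume UV: "opene_in X U \<and> opene_in X V"
  show "infinite (hits f U V)"
    unfolding infinite_nat_iff_unbounded_le
  proof
    fix N
    from UV assms(4) consider n where "n \<in> hits f U V" | n where "n \<in> hits f V U"
      unfolding cond_TT_iff by blast
    then show "\<exists>k\<ge>N. k \<in> hits f U V"
    proof cases
      case 1
      then have "opene_in X {x \<in> U. (f ^^ n) x \<in> V}"
        using UV assms(1) by (intro opene_in_funpow_preimage) auto
      \<comment> \<open>Of the return only two facts are kept: the start is in \<open>U\<close>, and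
        the endpoint is carried into \<open>V\<close> by \<open>n\<close> more steps.\<close>
      then obtain m x where m: "m \<ge> N" and x: "x \<in> U" "(f ^^ n) ((f ^^ m) x) \<in> V"
        using cond_TT_imp_large_return[OF assms, of _ N] by (fastforce simp: mem_hits_iff)
      then have "n + m \<in> hits f U V" by (auto simp: mem_hits_iff funpow_add)
      with m show ?thesis by (intro exI[of _ "n + m"]) auto
    next
      case 2
      then have "opene_in X {x \<in> V. (f ^^ n) x \<in> U}"
        using UV assms(1) by (intro opene_in_funpow_preimage) auto
      \<comment> \<open>The new starting point is \<open>(f ^^ n) x\<close>, which lies in
        \<open>U\<close>. The bound \<open>n + N\<close> makes up for the \<open>n\<close> steps
        already spent.\<close>
      then obtain m x where m: "m \<ge> n + N" and x: "(f ^^ n) x \<in> U" "(f ^^ m) x \<in> V"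
        using cond_TT_imp_large_return[OF assms, of _ "n + N"] by (fastforce simp: mem_hits_iff)
      have "(f ^^ (m - n)) ((f ^^ n) x) = (f ^^ m) x"
        using m by (simp add: funpow_diff_apply)
      with x have "m - n \<in> hits f U V" unfolding mem_hits_iff by metis
      with m show ?thesis by (intro exI[of _ "m - n"]) auto
    qed
  qed
qed

section \<open>Transitivity and indecomposability\<close>

lemma plus_invariant_funpow:
  assumes "plus_invariant f A" and "x \<in> A"
  shows "(f ^^ n) x \<in> A"
  using assms by (induction n) (auto simp: plus_invariant_def)

text \<open>A point outside \<open>A\<close> lies in \<open>B\<close> and stays there, so the
  complement of \<open>A\<close> never reaches that of \<open>B\<close>; the same holds with
  \<open>A\<close> and \<open>B\<close> exchanged.\<close>

lemma cond_TT_imp_IN: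
  assumes "cond_TT X f"
  shows "cond_IN X f"
  unfolding cond_IN_def
proof clarify
  fix A B
  assume cl: "closedin X A" "closedin X B" and ne: "A \<noteq> topspace X" "B \<noteq> topspace X"
    and inv: "plus_invariant f A" "plus_invariant f B" and cover: "topspace X = A \<union> B"
  have "opene_in X (topspace X - A)" "opene_in X (topspace X - B)"
    using cl ne closedin_subset by (fastforce simp: opene_in_def)+
  then obtain n where
    "n \<in> hits f (topspace X - A) (topspace X - B) \<or> n \<in> hits f (topspace X - B) (topspace X - A)"
    using assms unfolding cond_TT_iff by blast
  then show False
    using cover plus_invariant_funpow[OF inv(1)] plus_invariant_funpow[OF inv(2)]
    by (auto simp: mem_hits_iff)
qed

text \<open>For continuous \<open>f\<close> this is the largest +invariant subset of
  \<open>topspace X\<close> that misses \<open>U\<close>.\<close>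

definition never_reaching :: "'a topology \<Rightarrow> ('a \<Rightarrow> 'a) \<Rightarrow> 'a set \<Rightarrow> 'a set" where
  "never_reaching X f U = {x \<in> topspace X. \<forall>n. (f ^^ n) x \<notin> U}"

lemma closedin_never_reaching:
  assumes "continuous_map X X f" and "openin X U"
  shows "closedin X (never_reaching X f U)"
proof -
  have "never_reaching X f U = topspace X - (\<Union>n. {x \<in> topspace X. (f ^^ n) x \<in> U})"
    by (auto simp: never_reaching_def)
  then show ?thesis
    using openin_funpow_preimage[OF assms(1) openin_topspace assms(2)]
    by (auto intro!: closedin_diff openin_clauses(3))
qed

lemma plus_invariant_never_reaching:
  assumes "continuous_map X X f"
  shows "plus_invariant f (never_reaching X f U)"
proof -
  \<comment> \<open>Every iterate of \<open>f x\<close> is a later iterate of \<open>x\<close>, so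
    avoiding \<open>U\<close> passes from \<open>x\<close> to \<open>f x\<close>.\<close>
  have "(f ^^ n) (f x) = (f ^^ Suc n) x" for n x
    by (simp add: funpow_swap1)
  then show ?thesis
    using continuous_map_image_subset_topspace[OF assms]
    unfolding plus_invariant_def never_reaching_def by (auto simp del: funpow.simps)
qed

lemma never_reaching_neq_topspace:
  assumes "opene_in X U"
  shows "never_reaching X f U \<noteq> topspace X"
proof -
  obtain x where "x \<in> U" "x \<in> topspace X"
    using assms opene_in_subset_topspace by (fastforce simp: opene_in_def)
  moreover from this have "x \<notin> never_reaching X f U"
    by (auto simp: never_reaching_def intro: exI[of _ 0])
  ultimately show ?thesis by blast
qed

lemma cond_IN_imp_TT:
  assumes "continuous_map X X f" and "cond_IN X f"
  shows "cond_TT X f"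
  unfolding cond_TT_iff
proof (intro allI impI)
  fix U V assume UV: "opene_in X U \<and> opene_in X V"
  then have "topspace X \<noteq> never_reaching X f U \<union> never_reaching X f V"
    using assms closedin_never_reaching plus_invariant_never_reaching never_reaching_neq_topspace
    unfolding cond_IN_def opene_in_def by metis
  then obtain x m n where x: "(f ^^ m) x \<in> U" "(f ^^ n) x \<in> V"
    by (auto simp: never_reaching_def)
  show "hits f U V \<noteq> {} \<or> hits f V U \<noteq> {}"
  \<comment> \<open>The orbit of \<open>x\<close> runs from its earlier visit to its later one, in
    as many steps as the two times differ.\<close>
  proof (cases "m \<le> n")
    case True
    with x funpow_diff_apply have "n - m \<in> hits f U V" unfolding mem_hits_iff by metis
    then show ?thesis by blast
  next
    case False
    with x funpow_diff_apply have "m - n \<in> hits f V U" unfolding mem_hits_iff by (metis nat_le_linear)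
    then show ?thesis by blast
  qed
qed

section \<open>Dense orbits and omega-limit sets\<close>

lemma dense_in_diff_finite:
  assumes "t1_space X" and "no_isolated_points X" and "dense_in X A" and "finite F"
  shows "dense_in X (A - F)"
  unfolding dense_in_def dense_intersects_open
proof clarify
  fix T assume T: "openin X T" "T \<noteq> {}" and disj: "(A - F) \<inter> T = {}"
  \<comment> \<open>Removing a finite set keeps \<open>T\<close> open by T1, and nonempty because
    \<open>T\<close> is infinite; so density of \<open>A\<close> applies to
    \<open>T - F\<close>.\<close>
  have "openin X (T - F)"
  proof -
    have "closedin X (topspace X \<inter> F)"
      using assms(1,4) by (auto simp: t1_space_closedin_finite)
    moreover have "T - F = T - topspace X \<inter> F"
      using openin_subset[OF T(1)] by auto
    ultimately show ?thesis using T(1) by (metis openin_diff)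
  qed
  moreover have "infinite T"
    using perfect_open_infinite[OF assms(1,2)] T by (auto simp: opene_in_def)
  then have "T - F \<noteq> {}" using assms(4) by (metis Diff_eq_empty_iff finite_subset)
  ultimately have "A \<inter> (T - F) \<noteq> {}"
    using assms(3) unfolding dense_in_def dense_intersects_open by blast
  with disj show False by blast
qed

lemma cond_DO_plus_imp_plus_plus:
  assumes "t1_space X" and "no_isolated_points X" and "cond_DO_plus X f"
  shows "cond_DO_plus_plus X f"
proof -
  obtain x where x: "x \<in> topspace X" "dense_in X (forward_orbit f x)"
    using assms(3) by (auto simp: cond_DO_plus_def)
  have "X closure_of {(f ^^ k) x | k. k \<ge> n} = topspace X" for n
  proof -
    \<comment> \<open>The orbit without its first \<open>n\<close> values lies in the tail from
      \<open>n\<close>. The tail may be larger, since the orbit can come back to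
      \<open>?F\<close>.\<close>
    let ?F = "(\<lambda>k. (f ^^ k) x) ` {..<n}"
    have "forward_orbit f x - ?F \<subseteq> {(f ^^ k) x | k. k \<ge> n}"
      by (force simp: forward_orbit_def not_less)
    then have "X closure_of (forward_orbit f x - ?F) \<subseteq> X closure_of {(f ^^ k) x | k. k \<ge> n}"
      by (rule closure_of_mono)
    moreover have "X closure_of (forward_orbit f x - ?F) = topspace X"
      using dense_in_diff_finite[OF assms(1,2) x(2)] by (simp add: dense_in_def)
    ultimately show ?thesis
      by (intro subset_antisym closure_of_subset_topspace) simp
  qed
  then have "omega_limit X f x = topspace X"
    unfolding omega_limit_def by simp
  with x(1) show ?thesis unfolding cond_DO_plus_plus_def by blast
qed

lemma cond_DO_plus_plus_imp_plus:
  assumes "cond_DO_plus_plus X f"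
  shows "cond_DO_plus X f"
proof -
  obtain x where x: "x \<in> topspace X" "omega_limit X f x = topspace X"
    using assms by (auto simp: cond_DO_plus_plus_def)
  \<comment> \<open>The term \<open>n = 0\<close> of the intersection is the closure of the whole
    orbit.\<close>
  have "omega_limit X f x \<subseteq> X closure_of {(f ^^ k) x | k. k \<ge> 0}"
    unfolding omega_limit_def by blast
  also have "{(f ^^ k) x | k. k \<ge> 0} = forward_orbit f x"
    by (auto simp: forward_orbit_def)
  finally have "dense_in X (forward_orbit f x)"
    using x(2) closure_of_subset_topspace unfolding dense_in_def by (metis subset_antisym)
  with x(1) show ?thesis by (auto simp: cond_DO_plus_def)
qed

section \<open>Baire category and dense orbits\<close>

lemma nowhere_dense_in_never_reaching:
  assumes "continuous_map X X f" and "cond_TT_plus X f" and "opene_in X U"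
  shows "nowhere_dense_in X (never_reaching X f U)"
proof -
  let ?I = "X interior_of never_reaching X f U"
  have closed: "closedin X (never_reaching X f U)"
    using assms closedin_never_reaching by (auto simp: opene_in_def)
  \<comment> \<open>The set is closed, so nowhere density means \<open>?I = {}\<close>; a nonempty
    \<open>?I\<close> would be an opene set that never reaches \<open>U\<close>.\<close>
  have "hits f ?I U = {}"
    using interior_of_subset[of X "never_reaching X f U"]
    unfolding hits_def never_reaching_def by blast
  then have "?I = {}"
    using assms(2,3) unfolding cond_TT_plus_iff by (metis opene_in_def openin_interior_of)
  with closed show ?thesis
    by (simp add: nowhere_dense_in_def closure_of_closedin closedin_subset)
qed

lemma cond_TT_plus_imp_DO_plus:
  assumes "continuous_map X X f" and "second_countable X" and "non_meager X"
    and "cond_TT_plus X f"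
  shows "cond_DO_plus X f"
proof -
  obtain \<B> where \<B>: "countable \<B>" "\<And>V. V \<in> \<B> \<Longrightarrow> openin X V"
    "\<And>U x. openin X U \<Longrightarrow> x \<in> U \<Longrightarrow> \<exists>V\<in>\<B>. x \<in> V \<and> V \<subseteq> U"
    using assms(2) unfolding second_countable_def by metis
  \<comment> \<open>The empty set is left out because \<open>never_reaching X f {}\<close> is the
    whole space. A point outside \<open>\<Union>\<A>\<close> visits every nonempty basic open
    set.\<close>
  define \<A> where "\<A> = never_reaching X f ` (\<B> - {{}})"
  have "countable \<A>" using \<B>(1) by (simp add: \<A>_def)
  moreover have "nowhere_dense_in X A" if "A \<in> \<A>" for A
    using that \<B>(2) nowhere_dense_in_never_reaching[OF assms(1,4)]
    by (auto simp: \<A>_def opene_in_def)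
  ultimately have "\<Union>\<A> \<noteq> topspace X"
    using assms(3) unfolding non_meager_def by blast
  moreover have "\<Union>\<A> \<subseteq> topspace X" by (auto simp: \<A>_def never_reaching_def)
  ultimately obtain x where x: "x \<in> topspace X" "x \<notin> \<Union>\<A>" by blast
  have "dense_in X (forward_orbit f x)"
    unfolding dense_in_def dense_intersects_open
  proof clarify
    fix T assume T: "openin X T" "T \<noteq> {}" and disj: "forward_orbit f x \<inter> T = {}"
    then obtain V where V: "V \<in> \<B>" "V \<noteq> {}" "V \<subseteq> T" using \<B>(3) by blast
    with x obtain n where "(f ^^ n) x \<in> V" by (auto simp: \<A>_def never_reaching_def)
    with V disj show False by (auto simp: forward_orbit_def)
  qed
  with x(1) show ?thesis by (auto simp: cond_DO_plus_def)
qed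

theorem theorem1p4:
  fixes X :: "'a topology" and f :: "'a \<Rightarrow> 'a"
  assumes "dynamical_system X f"
    and "Hausdorff_space X"
  shows "(no_isolated_points X \<longrightarrow>
            (cond_TT_plus_plus X f \<longleftrightarrow> cond_TT_plus X f) \<and>
            (cond_TT_plus X f \<longleftrightarrow> cond_TT X f) \<and>
            (cond_TT X f \<longleftrightarrow> cond_IN X f)) \<and>
         (no_isolated_points X \<longrightarrow> (cond_DO_plus_plus X f \<longleftrightarrow> cond_DO_plus X f)) \<and>
         (second_countable X \<and> non_meager X \<longrightarrow> (cond_TT_plus X f \<longrightarrow> cond_DO_plus X f))"
proof -
  have cont: "continuous_map X X f"
    using assms(1) by (simp add: dynamical_system_def)
  have t1: "t1_space X"
    using assms(2) by (rule Hausdorff_imp_t1_space)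
  \<comment> \<open>The two easy implications down to \<open>cond_TT\<close> form a cycle with the
    one back to \<open>cond_TT_plus_plus\<close>; \<open>cond_IN\<close> is tied to
    \<open>cond_TT\<close>.\<close>
  have "cond_TT_plus X f" if "cond_TT_plus_plus X f"
    using that unfolding cond_TT_plus_plus_iff cond_TT_plus_iff by (metis finite.emptyI)
  moreover have "cond_TT X f" if "cond_TT_plus X f"
    using that unfolding cond_TT_plus_iff cond_TT_iff by blast
  ultimately show ?thesis
    using cond_TT_imp_TT_plus_plus[OF cont assms(2)] cond_TT_imp_IN cond_IN_imp_TT[OF cont]
      cond_DO_plus_imp_plus_plus[OF t1] cond_DO_plus_plus_imp_plus
      cond_TT_plus_imp_DO_plus[OF cont] by blast
qed

end
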